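(* Let $d\ge1$. For any $X=\{x^0,\dots,x^d\}\subseteq[0,1]^d$ consisting of finite points, $\operatorname{conv}_{\oplus}(X)$ contains a point $p$ that internally separates $x^0,\dots,x^d$.
   Context: For $a,b\in[0,1]$ put $a\oplus b=\max(a,b)$ and $a\otimes b=\min(a,b)$; these act on vectors of $[0,1]^d$ componentwise, with $(\lambda\otimes x)_k=\min(\lambda,x_k)$ for $\lambda\in[0,1]$, $x\in[0,1]^d$. A set $C\subseteq[0,1]^d$ is max-min convex if for all $x,y\in C$ and all $\alpha,\beta\in[0,1]$ with $\alpha\oplus\beta=1$ one has $\alpha\otimes x\oplus\beta\otimes y\in C$. For $X\subseteq[0,1]^d$, the convex hull $\operatorname{conv}_{\oplus}(X)$ is the smallest max-min convex set containing $X$; equivalently, the set of all combinations $\bigoplus_{i=1}^m\lambda_i\otimes x^i$ with $m\ge1$, $x^i\in X$, $\lambda_i\in[0,1]$, $\bigoplus_{i=1}^m\lambda_i=1$. A point of $[0,1]^d$ is finite if all its coordinates are different from $0$ and $1$. For a finite point $p\in[0,1]^d$ the semispaces at $p$ are the sets $$S_0(p)=\{x\in[0,1]^d : x_k>p_k\text{ for some }1\le k\le d\},$$ $$S_i(p)=\{x\in[0,1]^d : x_i<p_i,\ \text{or } x_k>p_k\text{ for some }k\text{ with }p_k<p_i\},\quad 1\le i\le d,$$ and $\complement S_i(p)=[0,1]^d\setminus S_i(p)$. Given $X=\{x^0,\dots,x^d\}$, a finite point $p\in\operatorname{conv}_{\oplus}(X)$ internally separates $x^0,\dots,x^d$ if,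 up to a permutation, each semispace $S_i(p)$ corresponds to $x^i\in\complement S_i(p)$; i.e. there is a permutation $\sigma$ of $\{0,\dots,d\}$ with $x^{\sigma(i)}\in\complement S_i(p)$ for all $0\le i\le d$. *)

theory Defs
  imports Complex_Main "HOL-Library.FuncSet" "HOL-Combinatorics.Permutations"
begin

text \<open>Points of $[0,1]^d$ are real functions on the coordinate set \<open>{1..d}\<close>, extended by
  \<^const>\<open>undefined\<close> elsewhere, so that equality of functions is equality of points.\<close>

definition cube :: "nat \<Rightarrow> (nat \<Rightarrow> real) set" where
  "cube d = {1..d} \<rightarrow>\<^sub>E {0..1}"

definition mm_add :: "nat \<Rightarrow> (nat \<Rightarrow> real) \<Rightarrow> (nat \<Rightarrow> real) \<Rightarrow> (nat \<Rightarrow> real)" where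
  "mm_add d x y = (\<lambda>k\<in>{1..d}. max (x k) (y k))"

definition mm_scale :: "nat \<Rightarrow> real \<Rightarrow> (nat \<Rightarrow> real) \<Rightarrow> (nat \<Rightarrow> real)" where
  "mm_scale d a x = (\<lambda>k\<in>{1..d}. min a (x k))"

definition mm_convex :: "nat \<Rightarrow> (nat \<Rightarrow> real) set \<Rightarrow> bool" where
  "mm_convex d C \<longleftrightarrow> C \<subseteq> cube d \<and>
     (\<forall>x\<in>C. \<forall>y\<in>C. \<forall>a\<in>{0..1}. \<forall>b\<in>{0..1}. max a b = 1 \<longrightarrow>
        mm_add d (mm_scale d a x) (mm_scale d b y) \<in> C)"

definition mm_conv :: "nat \<Rightarrow> (nat \<Rightarrow> real) set \<Rightarrow> (nat \<Rightarrow> real) set" where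
  "mm_conv d X = mm_convex d hull X"

lemma mm_convex_cube: "mm_convex d (cube d)"
  unfolding mm_convex_def cube_def mm_add_def mm_scale_def
  by (auto simp: PiE_iff min_def max_def)

lemma mm_convex_mm_conv:
  assumes "X \<subseteq> cube d"
  shows "mm_convex d (mm_conv d X)"
proof -
  have "mm_conv d X \<subseteq> cube d"
    unfolding mm_conv_def using assms mm_convex_cube by (rule hull_minimal)
  then show ?thesis
    unfolding mm_convex_def mm_conv_def hull_def by blast
qed

definition finite_point :: "nat \<Rightarrow> (nat \<Rightarrow> real) \<Rightarrow> bool" where
  "finite_point d p \<longleftrightarrow> p \<in> cube d \<and> (\<forall>k\<in>{1..d}. p k \<noteq> 0 \<and> p k \<noteq> 1)"

definition semispace :: "nat \<Rightarrow> nat \<Rightarrow> (nat \<Rightarrow> real) \<Rightarrow> (nat \<Rightarrow> real) set" where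
  "semispace d i p =
     (if i = 0 then {x \<in> cube d. \<exists>k\<in>{1..d}. x k > p k}
      else {x \<in> cube d. x i < p i \<or> (\<exists>k\<in>{1..d}. p k < p i \<and> x k > p k)})"

definition internally_separates ::
    "nat \<Rightarrow> (nat \<Rightarrow> real) \<Rightarrow> (nat \<Rightarrow> nat \<Rightarrow> real) \<Rightarrow> bool" where
  "internally_separates d p x \<longleftrightarrow>
     finite_point d p \<and> p \<in> mm_conv d (x ` {0..d}) \<and>
     (\<exists>\<sigma>. \<sigma> permutes {0..d} \<and> (\<forall>i\<in>{0..d}. x (\<sigma> i) \<in> cube d - semispace d i p))"

end

theory Submission
  imports Defs
begin

text \<open>
  Membership in the hull comes for free: write \<open>y\<^sup>i\<close> for the point assigned to the semispace
  \<open>S\<^sub>i(p)\<close>. If \<open>y\<^sup>0 \<le> p\<close> and each \<open>y\<^sup>i\<close> avoids \<open>S\<^sub>i(p)\<close>, then \<open>p\<close> is the componentwise maximum of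
  \<open>y\<^sup>0\<close> and of all \<open>p\<^sub>i \<otimes> y\<^sup>i\<close>; finiteness of \<open>p\<close> is equally automatic. What remains is
  a matching problem for coordinates versus points. Start with the complete bipartite graph, in which
  every nonempty set \<open>U\<close> of coordinates has at least \<open>|U| + 1\<close> neighbours, and delete the edges
  \<open>(k, j)\<close> in increasing order of \<open>x\<^sup>j\<^sub>k\<close>. When deleting an edge of value \<open>t\<close> first destroys the
  surplus, a maximal set \<open>T\<close> without surplus has exactly \<open>|T|\<close> neighbours. Hall's theorem matches
  \<open>T\<close> with them; put \<open>p = t\<close> on \<open>T\<close> and continue with the remaining coordinates and points,
  where maximality of \<open>T\<close> restores the surplus.
\<close>

text \<open>Hall's theorem by splitting: a nonempty proper subset of \<open>I\<close> that is tight
  can be matched separately from its complement; if there is none, any admissible value may be fixed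
  for one index.\<close>

lemma Hall_marriage:
  assumes "finite I" "\<And>i. i \<in> I \<Longrightarrow> finite (A i)"
    and "\<And>T. T \<subseteq> I \<Longrightarrow> card T \<le> card (\<Union>(A ` T))"
  shows "\<exists>f. inj_on f I \<and> (\<forall>i\<in>I. f i \<in> A i)"
  using assms
proof (induction I arbitrary: A rule: finite_psubset_induct)
  case (psubset I)
  note fin = \<open>finite I\<close> and finA = psubset.prems(1) and hall = psubset.prems(2)
  show ?case
  proof (cases "I = {}")
    case False
    then obtain i where i: "i \<in> I" by blast
    show ?thesis
    proof (cases "\<exists>T. T \<subset> I \<and> T \<noteq> {} \<and> card (\<Union>(A ` T)) \<le> card T")
      case True
      then obtain T where T: "T \<subset> I" "T \<noteq> {}" and tight: "card (\<Union>(A ` T)) \<le> card T" by blast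
      define P where "P = \<Union>(A ` T)"
      have "finite T" using T fin finite_subset by blast
      have "finite P" using T finA \<open>finite T\<close> unfolding P_def by blast
      have "\<exists>f. inj_on f T \<and> (\<forall>i\<in>T. f i \<in> A i)"
        by (rule psubset.IH[OF T(1)]) (use T finA hall in auto)
      then obtain f where f: "inj_on f T" "\<forall>i\<in>T. f i \<in> A i" by blast
      \<comment> \<open>Hall's condition survives outside \<open>T\<close>: at most
        \<open>card T\<close> of the neighbours of \<open>T \<union> U\<close> lie in
        \<open>P\<close>.\<close>
      have "\<exists>g. inj_on g (I - T) \<and> (\<forall>i\<in>I - T. g i \<in> A i - P)"
      proof (rule psubset.IH)
        show "I - T \<subset> I" using T by blast
        show "finite (A i - P)" if "i \<in> I - T" for i using that finA by blast
        fix U assume U: "U \<subseteq> I - T"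
        have "finite U" using U fin finite_subset by blast
        have "card T + card U = card (T \<union> U)"
          using U \<open>finite T\<close> \<open>finite U\<close> by (subst card_Un_disjoint) auto
        also have "\<dots> \<le> card (\<Union>(A ` (T \<union> U)))" using U T by (intro hall) auto
        also have "\<Union>(A ` (T \<union> U)) = P \<union> (\<Union>i\<in>U. A i - P)" by (auto simp: P_def)
        also have "card \<dots> \<le> card P + card (\<Union>i\<in>U. A i - P)" by (rule card_Un_le)
        finally show "card U \<le> card (\<Union>i\<in>U. A i - P)" using tight by (simp add: P_def)
      qed
      then obtain g where g: "inj_on g (I - T)" "\<forall>i\<in>I - T. g i \<in> A i - P" by blast
      have "f ` T \<subseteq> P" using f by (auto simp: P_def)
      then have "inj_on (\<lambda>i. if i \<in> T then f i else g i) I"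
        using f g unfolding inj_on_def by (smt (verit) DiffE DiffI image_subset_iff)
      then show ?thesis using f g by (intro exI[of _ "\<lambda>i. if i \<in> T then f i else g i"]) auto
    next
      case False
      then have surplus: "card T < card (\<Union>(A ` T))" if "T \<subset> I" "T \<noteq> {}" for T
        using that by (meson not_le)
      have "A i \<noteq> {}" using hall[of "{i}"] i by auto
      then obtain a where a: "a \<in> A i" by blast
      \<comment> \<open>Removing \<open>a\<close> costs each union at most one element, which the
        surplus pays for.\<close>
      have "\<exists>g. inj_on g (I - {i}) \<and> (\<forall>k\<in>I - {i}. g k \<in> A k - {a})"
      proof (rule psubset.IH)
        show "I - {i} \<subset> I" using i by blast
        show "finite (A k - {a})" if "k \<in> I - {i}" for k using that finA by blast
        fix U assume U: "U \<subseteq> I - {i}"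
        show "card U \<le> card (\<Union>k\<in>U. A k - {a})"
        proof (cases "U = {}")
          case False
          have "(\<Union>k\<in>U. A k - {a}) = \<Union>(A ` U) - {a}" by blast
          moreover have "card U < card (\<Union>(A ` U))" using U i False by (intro surplus) auto
          ultimately show ?thesis
            using diff_card_le_card_Diff[of "{a}" "\<Union>(A ` U)"] by simp
        qed auto
      qed
      then obtain g where g: "inj_on g (I - {i})" "\<forall>k\<in>I - {i}. g k \<in> A k - {a}" by blast
      have "inj_on (g(i := a)) I"
        using g unfolding inj_on_def by auto
      moreover have "\<forall>k\<in>I. (g(i := a)) k \<in> A k" using g a by simp
      ultimately show ?thesis by blast
    qed
  qed auto
qed

lemma level_matching:
  fixes v :: "'k \<Rightarrow> 'j \<Rightarrow> real"
  assumes "finite K" "finite J" "card J = card K + 1"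
    and "\<And>k. k \<in> K \<Longrightarrow> A k \<subseteq> J"
    and "\<And>U. U \<subseteq> K \<Longrightarrow> U \<noteq> {} \<Longrightarrow> card U < card (\<Union>(A ` U))"
    and "\<And>k j i l. k \<in> K \<Longrightarrow> j \<in> J - A k \<Longrightarrow> i \<in> K \<Longrightarrow> l \<in> A i \<Longrightarrow> v k j \<le> v i l"
  shows "\<exists>p f z. z \<in> J \<and> bij_betw f K (J - {z}) \<and>
    (\<forall>k\<in>K. \<exists>i\<in>K. \<exists>j\<in>A i. v i j \<le> p k) \<and>
    (\<forall>k\<in>K. v k z \<le> p k \<and> p k \<le> v k (f k)) \<and>
    (\<forall>i\<in>K. \<forall>k\<in>K. p k < p i \<longrightarrow> v k (f i) \<le> p k)"
  using assms
proof (induction "card (Sigma K A)" arbitrary: K J A rule: less_induct)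
  case less
  note fin = less.prems(1,2) and cardJ = less.prems(3) and AJ = less.prems(4)
    and surplus = less.prems(5) and order = less.prems(6)
  have finA: "finite (A k)" if "k \<in> K" for k using AJ that fin finite_subset by blast
  have finS: "finite (Sigma K A)" using fin finA by blast
  show ?case
  proof (cases "K = {}")
    case True
    then obtain z where "J = {z}" using cardJ by (auto simp: card_1_singleton_iff)
    then show ?thesis using True by (auto simp: bij_betw_def)
  next
    case False
    then obtain k' where "k' \<in> K" by blast
    then have "A k' \<noteq> {}" using surplus[of "{k'}"] by auto
    then have "Sigma K A \<noteq> {}" using \<open>k' \<in> K\<close> by blast
    \<comment> \<open>The least surviving edge is the next to be deleted; its value
      \<open>v k0 j0\<close> becomes the level of a block \<open>T\<close> if the surplus
      breaks.\<close>
    then obtain e where e: "e \<in> Sigma K A" "\<forall>e'\<in>Sigma K A. case_prod v e \<le> case_prod v e'"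
      using finS ex_is_arg_min_if_finite[of "Sigma K A" "case_prod v"] by (auto simp: is_arg_min_linorder)
    obtain k0 j0 where "e = (k0, j0)" by force
    then have k0: "k0 \<in> K" and j0: "j0 \<in> A k0"
      and least: "\<And>i l. i \<in> K \<Longrightarrow> l \<in> A i \<Longrightarrow> v k0 j0 \<le> v i l"
      using e by force+
    define B where "B = A(k0 := A k0 - {j0})"
    have BA: "B k \<subseteq> A k" for k by (auto simp: B_def)
    have AB: "A k \<subseteq> insert j0 (B k)" for k by (auto simp: B_def)
    have B_eq: "B k = A k" if "k \<noteq> k0" for k using that by (auto simp: B_def)
    \<comment> \<open>\<open>v k0 j0\<close> separates deleted from surviving values, which yields
      the order hypothesis of both recursive calls.\<close>
    have nonedge: "v k j \<le> v k0 j0" if "k \<in> K" "j \<in> J - B k" for k j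
      using that order[of k j k0 j0] k0 j0 by (auto simp: B_def split: if_splits)
    show ?thesis
    proof (cases "\<forall>U\<subseteq>K. U \<noteq> {} \<longrightarrow> card U < card (\<Union>(B ` U))")
      case True
      have "Sigma K B \<subset> Sigma K A" using k0 j0 by (fastforce simp: B_def split: if_splits)
      then have "card (Sigma K B) < card (Sigma K A)" by (rule psubset_card_mono[OF finS])
      then have "\<exists>p f z. z \<in> J \<and> bij_betw f K (J - {z}) \<and>
        (\<forall>k\<in>K. \<exists>i\<in>K. \<exists>j\<in>B i. v i j \<le> p k) \<and>
        (\<forall>k\<in>K. v k z \<le> p k \<and> p k \<le> v k (f k)) \<and>
        (\<forall>i\<in>K. \<forall>k\<in>K. p k < p i \<longrightarrow> v k (f i) \<le> p k)"
      proof (rule less.hyps[of K B J])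
        show "v k j \<le> v i l" if "k \<in> K" "j \<in> J - B k" "i \<in> K" "l \<in> B i" for k j i l
          using nonedge[OF that(1,2)] least[OF that(3)] that(4) BA by force
        show "B k \<subseteq> J" if "k \<in> K" for k using BA AJ[OF that] by (rule subset_trans)
        show "card U < card (\<Union>(B ` U))" if "U \<subseteq> K" "U \<noteq> {}" for U using True that by simp
      qed (fact fin cardJ)+
      moreover have "\<exists>i\<in>K. \<exists>j\<in>A i. v i j \<le> c" if "\<exists>i\<in>K. \<exists>j\<in>B i. v i j \<le> c" for c
        using that BA by blast
      ultimately show ?thesis by (elim ex_forward conj_forward) simp_all
    next
      case False
      define F where "F = {T. T \<subseteq> K \<and> T \<noteq> {} \<and> card (\<Union>(B ` T)) \<le> card T}"
      have "finite F" "F \<noteq> {}" using fin False by (auto simp: F_def not_less)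
      then obtain T where TF: "T \<in> F" and Tmax: "\<And>T'. T' \<in> F \<Longrightarrow> T \<subseteq> T' \<Longrightarrow> T = T'"
        using finite_has_maximal[of F] by blast
      then have T: "T \<subseteq> K" "T \<noteq> {}" and Tle: "card (\<Union>(B ` T)) \<le> card T" by (auto simp: F_def)
      have finT: "finite T" using T fin finite_subset by blast
      define P where "P = \<Union>(B ` T)"
      have PJ: "P \<subseteq> J" using T AJ BA unfolding P_def by blast
      then have finP: "finite P" using fin finite_subset by blast
      \<comment> \<open>One deletion removes at most the neighbour \<open>j0\<close>, so the strict
        surplus of \<open>A\<close> leaves Hall's condition for \<open>B\<close>.\<close>
      have hall: "card U \<le> card (\<Union>(B ` U))" if "U \<subseteq> K" for U
      proof (cases "U = {}")
        case False
        have finU: "finite (\<Union>(B ` U))" using that AJ BA fin by (intro finite_subset[of "\<Union>(B ` U)" J]) blast+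
        have "card U < card (\<Union>(A ` U))" using surplus that False by blast
        also have "\<dots> \<le> card (insert j0 (\<Union>(B ` U)))"
          using AB finU by (intro card_mono) auto
        also have "\<dots> \<le> Suc (card (\<Union>(B ` U)))" by (simp add: card_insert_if finU)
        finally show ?thesis by simp
      qed auto
      have cardP: "card P = card T" using hall[OF T(1)] Tle by (simp add: P_def)
      \<comment> \<open>A set avoiding \<open>k0\<close> keeps its neighbours, hence its surplus.
        With \<open>k0\<close> in \<open>T\<close>, its edge to \<open>j0\<close> is absent from the
        next graph, so the measure drops.\<close>
      have "k0 \<in> T"
      proof (rule ccontr)
        assume "k0 \<notin> T"
        then have "\<Union>(B ` T) = \<Union>(A ` T)" using B_eq by (metis (mono_tags, lifting) SUP_cong)
        then show False using surplus[OF T] Tle by simp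
      qed
      have "\<exists>f. inj_on f T \<and> (\<forall>i\<in>T. f i \<in> B i)"
      proof (rule Hall_marriage[OF finT])
        show "finite (B i)" if "i \<in> T" for i using finite_subset[OF BA finA, of i] that T by blast
        show "card U \<le> card (\<Union>(B ` U))" if "U \<subseteq> T" for U using hall that T by blast
      qed
      then obtain f where f: "inj_on f T" "\<And>i. i \<in> T \<Longrightarrow> f i \<in> B i" by blast
      \<comment> \<open>Equal cardinalities make \<open>f\<close> use up all of \<open>P\<close>, so
        the recursion can discard \<open>P\<close> together with \<open>T\<close>.\<close>
      have "f ` T = P"
      proof (rule card_subset_eq[OF finP])
        show "f ` T \<subseteq> P" using f by (auto simp: P_def)
      qed (simp add: card_image f cardP)
      then have bijf: "bij_betw f T P" using f by (simp add: bij_betw_def)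
      define C where "C k = B k - P" for k
      have "Sigma (K - T) C \<subset> Sigma K A" using \<open>k0 \<in> T\<close> k0 j0 subsetD[OF BA] by (auto simp: C_def)
      then have "card (Sigma (K - T) C) < card (Sigma K A)" by (rule psubset_card_mono[OF finS])
      then have "\<exists>p f z. z \<in> J - P \<and> bij_betw f (K - T) (J - P - {z}) \<and>
        (\<forall>k\<in>K - T. \<exists>i\<in>K - T. \<exists>j\<in>C i. v i j \<le> p k) \<and>
        (\<forall>k\<in>K - T. v k z \<le> p k \<and> p k \<le> v k (f k)) \<and>
        (\<forall>i\<in>K - T. \<forall>k\<in>K - T. p k < p i \<longrightarrow> v k (f i) \<le> p k)"
      proof (rule less.hyps[of "K - T" C "J - P"])
        have "card T \<le> card K" using T fin by (simp add: card_mono)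
        then show "card (J - P) = card (K - T) + 1"
          using card_Diff_subset[OF finP PJ] card_Diff_subset[OF finT T(1)] cardP cardJ by simp
        show "C k \<subseteq> J - P" if "k \<in> K - T" for k using that AJ BA unfolding C_def by blast
        show "v k j \<le> v i l" if "k \<in> K - T" "j \<in> J - P - C k" "i \<in> K - T" "l \<in> C i" for k j i l
          using nonedge[of k j] least[of i l] that BA by (force simp: C_def)
        fix U assume U: "U \<subseteq> K - T" "U \<noteq> {}"
        have finU: "finite U" using U fin finite_subset by blast
        \<comment> \<open>\<open>T \<union> U\<close> strictly contains the maximal
          \<open>T\<close>, so it has surplus; subtracting \<open>card P = card T\<close> leaves the
          surplus of \<open>U\<close>.\<close>
        have "T \<union> U \<notin> F" using Tmax[of "T \<union> U"] U by blast
        then have "card (T \<union> U) < card (\<Union>(B ` (T \<union> U)))" using T U by (auto simp: F_def)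
        also have "\<Union>(B ` (T \<union> U)) = P \<union> \<Union>(C ` U)" by (auto simp: P_def C_def)
        also have "card \<dots> \<le> card P + card (\<Union>(C ` U))" by (rule card_Un_le)
        also have "card (T \<union> U) = card T + card U"
          using U finT finU by (intro card_Un_disjoint) auto
        finally show "card U < card (\<Union>(C ` U))" using cardP by simp
      qed (use fin in auto)
      then obtain p g z where z: "z \<in> J - P" and bijg: "bij_betw g (K - T) (J - P - {z})"
        and low: "\<And>k. k \<in> K - T \<Longrightarrow> \<exists>i\<in>K - T. \<exists>j\<in>C i. v i j \<le> p k"
        and pg: "\<And>k. k \<in> K - T \<Longrightarrow> v k z \<le> p k \<and> p k \<le> v k (g k)"
        and ordg: "\<And>i k. i \<in> K - T \<Longrightarrow> k \<in> K - T \<Longrightarrow> p k < p i \<Longrightarrow> v k (g i) \<le> p k"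
        by blast
      define q where "q k = (if k \<in> T then v k0 j0 else p k)" for k
      define h where "h k = (if k \<in> T then f k else g k)" for k
      \<comment> \<open>The lower bound in the induction hypothesis makes the level on
        \<open>T\<close> the smallest one.\<close>
      have qlow: "v k0 j0 \<le> q k" if k: "k \<in> K" for k
      proof (cases "k \<in> T")
        case False
        then obtain i j where "i \<in> K - T" "j \<in> C i" "v i j \<le> p k" using low k by blast
        then show ?thesis using least[of i j] BA False by (force simp: q_def C_def)
      qed (simp add: q_def)
      \<comment> \<open>All edges from \<open>T\<close> to points outside \<open>P\<close> are
        already deleted, so their values are at most the level on \<open>T\<close>.\<close>
      have outside: "v k j \<le> q k" if "k \<in> T" "j \<in> J - P" for k j
        using nonedge[of k j] that T by (auto simp: q_def P_def)
      have "bij_betw h (T \<union> (K - T)) (P \<union> (J - P - {z}))"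
      proof (rule bij_betw_combine)
        show "bij_betw h T P" using bijf by (simp add: h_def cong: bij_betw_cong)
        have "bij_betw h (K - T) (J - P - {z}) \<longleftrightarrow> bij_betw g (K - T) (J - P - {z})"
          by (rule bij_betw_cong) (simp add: h_def)
        then show "bij_betw h (K - T) (J - P - {z})" using bijg by simp
      qed auto
      moreover have "T \<union> (K - T) = K" "P \<union> (J - P - {z}) = J - {z}" using T PJ z by auto
      ultimately have "bij_betw h K (J - {z})" by simp
      moreover have "\<exists>i\<in>K. \<exists>j\<in>A i. v i j \<le> q k" if "k \<in> K" for k
        using qlow[OF that] k0 j0 by blast
      moreover have "v k z \<le> q k \<and> q k \<le> v k (h k)" if "k \<in> K" for k
      proof (cases "k \<in> T")
        case True
        then show ?thesis using outside[of k z] z f(2)[OF True] BA least[OF that, of "f k"]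
          by (auto simp: q_def h_def)
      qed (use pg that in \<open>simp add: q_def h_def\<close>)
      \<comment> \<open>\<open>q k < q i\<close> excludes \<open>i\<close> from \<open>T\<close>,
        whose level is least; so \<open>h i\<close> lies outside \<open>P\<close>.\<close>
      moreover have "v k (h i) \<le> q k" if "i \<in> K" "k \<in> K" "q k < q i" for i k
      proof -
        have iT: "i \<notin> T" using qlow[OF that(2)] that(3) by (auto simp: q_def)
        have "g i \<in> J - P" using bijg iT that by (auto simp: bij_betw_def)
        then show ?thesis
          using outside[of k "g i"] ordg[of i k] that iT by (auto simp: h_def q_def split: if_splits)
      qed
      ultimately show ?thesis using z
        by (intro exI[of _ q] exI[of _ h] exI[of _ z]) simp
    qed
  qed
qed

text \<open>\<open>p\<close> is the maximum of \<open>y\<close> and all \<open>u i\<close> capped at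
  \<open>p i\<close>: the cap keeps coordinates with \<open>p k \<ge> p i\<close> below
  \<open>p\<close>, the last hypothesis the others. Adding one index at a time reduces this to
  binary combinations.\<close>

lemma mm_convex_memI:
  assumes C: "mm_convex d C" and p: "p \<in> cube d"
    and y: "y \<in> C" "\<And>k. k \<in> {1..d} \<Longrightarrow> y k \<le> p k"
    and u: "\<And>i. i \<in> {1..d} \<Longrightarrow> u i \<in> C"
      "\<And>i. i \<in> {1..d} \<Longrightarrow> p i \<le> u i i"
      "\<And>i k. i \<in> {1..d} \<Longrightarrow> k \<in> {1..d} \<Longrightarrow> p k < p i \<Longrightarrow> u i k \<le> p k"
  shows "p \<in> C"
proof -
  have "\<exists>q\<in>C. (\<forall>k\<in>{1..d}. q k \<le> p k) \<and> (\<forall>i\<in>I. p i \<le> q i)" if "finite I" "I \<subseteq> {1..d}" for I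
    using that
  proof induction
    case empty
    then show ?case using y by blast
  next
    case (insert i I)
    then obtain q where q: "q \<in> C" "\<forall>k\<in>{1..d}. q k \<le> p k" "\<forall>i\<in>I. p i \<le> q i" by blast
    have i: "i \<in> {1..d}" using insert by blast
    have "p i \<in> {0..1}" using p i by (auto simp: cube_def)
    \<comment> \<open>The coefficients 1 and \<open>p i\<close> have maximum 1, as convexity
      requires; scaling by 1 leaves \<open>q\<close> unchanged because its coordinates are at most
      1.\<close>
    then have "mm_add d (mm_scale d 1 q) (mm_scale d (p i) (u i)) \<in> C" (is "?q \<in> C")
      using C q(1) u(1)[OF i] unfolding mm_convex_def by force
    have 1: "q k \<le> 1" if "k \<in> {1..d}" for k using q that p by (force simp: cube_def PiE_iff)
    have q': "?q k = max (q k) (min (p i) (u i k))" if "k \<in> {1..d}" for k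
      using 1[OF that] that by (simp add: mm_add_def mm_scale_def)
    have "?q k \<le> p k" if "k \<in> {1..d}" for k
      using q'[OF that] q(2) u(3)[OF i that] that by (force simp: min_def max_def)
    moreover have "p k \<le> ?q k" if "k \<in> insert i I" for k
      using q'[of k] q(3) u(2)[OF i] that insert.prems by fastforce
    ultimately show ?case using \<open>?q \<in> C\<close> by blast
  qed
  from this[of "{1..d}"] obtain q
    where q: "q \<in> C" "\<forall>k\<in>{1..d}. q k \<le> p k" "\<forall>i\<in>{1..d}. p i \<le> q i" by auto
  have "q \<in> cube d" using q(1) C by (auto simp: mm_convex_def)
  then have "q = p" using p q by (intro PiE_ext[of q "{1..d}" _ p]) (auto simp: cube_def intro: antisym)
  then show ?thesis using q by simp
qed

theorem theorem9:
  fixes d :: nat and x :: "nat \<Rightarrow> nat \<Rightarrow> real"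
  assumes "d \<ge> 1"
    and "\<And>i. i \<in> {0..d} \<Longrightarrow> finite_point d (x i)"
  shows "\<exists>p \<in> mm_conv d (x ` {0..d}). internally_separates d p x"
proof -
  have cube: "x i \<in> cube d" if "i \<in> {0..d}" for i using assms(2)[OF that] by (simp add: finite_point_def)
  have pos: "0 < x i k" and less1: "x i k < 1" if "i \<in> {0..d}" "k \<in> {1..d}" for i k
    using assms(2)[OF that(1)] that(2) by (force simp: finite_point_def cube_def PiE_iff)+
  have "\<exists>p f z. z \<in> {0..d} \<and> bij_betw f {1..d} ({0..d} - {z}) \<and>
    (\<forall>k\<in>{1..d}. \<exists>i\<in>{1..d}. \<exists>j\<in>{0..d}. x j i \<le> p k) \<and>
    (\<forall>k\<in>{1..d}. x z k \<le> p k \<and> p k \<le> x (f k) k) \<and>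
    (\<forall>i\<in>{1..d}. \<forall>k\<in>{1..d}. p k < p i \<longrightarrow> x (f i) k \<le> p k)"
  \<comment> \<open>In the complete graph every nonempty \<open>U\<close> has all
    \<open>d + 1\<close> points as neighbours, and with no edge deleted the order hypothesis is
    vacuous.\<close>
  proof (rule level_matching[of _ _ "\<lambda>_. {0..d}" "\<lambda>k j. x j k"])
    fix U assume "U \<subseteq> {1..d}" "U \<noteq> {}"
    then show "card U < card (\<Union>((\<lambda>_. {0..d}) ` U))"
      using card_mono[of "{1..d}" U] by simp
  qed auto
  then obtain p0 f z where z: "z \<in> {0..d}" and f: "bij_betw f {1..d} ({0..d} - {z})"
    and p0: "\<And>k. k \<in> {1..d} \<Longrightarrow> x z k \<le> p0 k \<and> p0 k \<le> x (f k) k"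
    and sep: "\<And>i k. i \<in> {1..d} \<Longrightarrow> k \<in> {1..d} \<Longrightarrow> p0 k < p0 i \<Longrightarrow> x (f i) k \<le> p0 k"
    by blast
  have f_in: "f i \<in> {0..d}" if "i \<in> {1..d}" for i using bij_betwE[OF f] that by blast
  \<comment> \<open>Points of \<open>cube d\<close> must be \<open>undefined\<close> outside
    \<open>{1..d}\<close>.\<close>
  define p where "p = restrict p0 {1..d}"
  have p_eq: "p k = p0 k" if "k \<in> {1..d}" for k using that by (simp add: p_def)
  \<comment> \<open>Finiteness is inherited: \<open>p k\<close> lies between coordinates of the
    finite points \<open>x z\<close> and \<open>x (f k)\<close>.\<close>
  have bounds: "0 < p k \<and> p k < 1" if "k \<in> {1..d}" for k
    using p0[OF that] pos[OF z that] less1[OF f_in that] that p_eq by fastforce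
  have p_cube: "p \<in> cube d"
    unfolding cube_def using bounds by (auto simp: p_def less_imp_le)
  then have fp: "finite_point d p" using bounds by (force simp: finite_point_def)
  have X: "x ` {0..d} \<subseteq> cube d" using cube by blast
  have sub: "x i \<in> mm_conv d (x ` {0..d})" if "i \<in> {0..d}" for i
    unfolding mm_conv_def using that by (intro hull_inc) auto
  have hull: "p \<in> mm_conv d (x ` {0..d})"
  proof (rule mm_convex_memI[OF mm_convex_mm_conv[OF X] p_cube])
    show "x z \<in> mm_conv d (x ` {0..d})" using sub z .
    show "x (f i) \<in> mm_conv d (x ` {0..d})" if "i \<in> {1..d}" for i using sub f_in that by blast
  qed (use p0 sep p_eq in auto)
  \<comment> \<open>The leftover point serves \<open>S_0\<close>; the identity outside
    \<open>{0..d}\<close> is what \<open>permutes\<close> demands.\<close>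
  define \<sigma> where "\<sigma> i = (if i = 0 then z else if i \<in> {1..d} then f i else i)" for i
  have "bij_betw \<sigma> ({0} \<union> {1..d}) ({z} \<union> ({0..d} - {z}))"
  proof (rule bij_betw_combine)
    have "bij_betw \<sigma> {1..d} ({0..d} - {z}) \<longleftrightarrow> bij_betw f {1..d} ({0..d} - {z})"
      by (rule bij_betw_cong) (simp add: \<sigma>_def)
    then show "bij_betw \<sigma> {1..d} ({0..d} - {z})" using f by simp
  qed (auto simp: \<sigma>_def)
  moreover have "{0} \<union> {1..d} = {0..d}" "{z} \<union> ({0..d} - {z}) = {0..d}" using z by auto
  ultimately have perm: "\<sigma> permutes {0..d}"
    by (intro bij_imp_permutes) (auto simp: \<sigma>_def)
  \<comment> \<open>Avoiding \<open>S_0\<close> means \<open>x z \<le> p\<close>; avoiding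
    \<open>S_i\<close> means \<open>p i \<le> x (f i) i\<close> together with
    \<open>sep\<close>.\<close>
  have "x (\<sigma> i) \<in> cube d - semispace d i p" if "i \<in> {0..d}" for i
  proof (cases "i = 0")
    case True
    then show ?thesis using cube z p0 p_eq by (force simp: \<sigma>_def semispace_def)
  next
    case False
    then have i: "i \<in> {1..d}" using that by auto
    then show ?thesis
      using False cube[OF f_in[OF i]] p0[OF i] sep[OF i] p_eq
      by (force simp: \<sigma>_def semispace_def)
  qed
  then show ?thesis using hull fp perm unfolding internally_separates_def by blast
qed

end
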